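(* Let $\alpha,\beta>0$ satisfy $-2\le\alpha-2\beta<1$, let $T>0$, and let $u$ be a smooth positive solution to $$u_t=(u^\beta)_{xx}\ \text{ in }\mathbb{T},\ 0<t\le T,\qquad u(\cdot,0)=u_0\ \text{ in }\mathbb{T},$$ on the one-dimensional torus $\Omega=\mathbb{T}$, where $u_0\in L^\infty(\Omega)$ with $\inf_\Omega u_0\ge 0$. Then $$F_\alpha[u(t)]\le F_\alpha[u_0]\,e^{-\Lambda t},\qquad 0\le t\le T,$$ where $$\Lambda=\frac{2\beta}{C_P^2}\,\inf_\Omega\big(u_0^{\alpha+\beta-\gamma-1}\big)\,\inf_\Omega\big(u_0^{\gamma-\alpha}\big)\ge 0,\qquad \gamma=\frac23(\alpha+\beta-1),$$ and $C_P>0$ is the Poincaré-Wirtinger constant on $\Omega=\mathbb{T}$.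
   Context: The one-dimensional torus $\mathbb{T}$ is normalized to have measure $1$. The first-order entropy is $F_\alpha[u]=\frac12\int_\Omega |(u^{\alpha/2})_x|^2\,dx$. The constant $C_P>0$ satisfies $\|f-\bar f\|_{L^2(\Omega)}\le C_P\|f_x\|_{L^2(\Omega)}$ for all $f\in H^1(\Omega)$, where $\bar f=\int_\Omega f\,dx$. Throughout, solutions are assumed smooth and positive, so that all computations and integrations by parts are justified (including up to the initial time $t=0$). *)

theory Defs
  imports "HOL-Analysis.Analysis" "HOL-Library.Periodic_Fun"
begin

text \<open>
  Functions on the torus are represented by functions on the reals of period 1
  (\<^const>\<open>periodic_fun_simple'\<close>). Integrals over the torus are taken over the fundamental
  domain \<open>{0..<1}\<close>, so that the torus has measure 1.
\<close>

definition torus :: "real measure" where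
  "torus = restrict_space lborel {0..<1}"

definition L2_torus :: "(real \<Rightarrow> real) set" where
  "L2_torus = {f. f \<in> borel_measurable torus \<and> integrable torus (\<lambda>x. (f x)\<^sup>2)}"

definition Linf_torus :: "(real \<Rightarrow> real) set" where
  "Linf_torus = {f. f \<in> borel_measurable torus \<and> (\<exists>M. AE x in torus. \<bar>f x\<bar> \<le> M)}"

definition L2_norm_torus :: "(real \<Rightarrow> real) \<Rightarrow> real" where
  "L2_norm_torus f = sqrt (\<integral>x. (f x)\<^sup>2 \<partial>torus)"

definition mean_torus :: "(real \<Rightarrow> real) \<Rightarrow> real" where
  "mean_torus f = (\<integral>x. f x \<partial>torus)"

definition test_fun_torus :: "(real \<Rightarrow> real) set" where
  "test_fun_torus =
     {\<phi>. periodic_fun_simple' \<phi> \<and> (\<forall>n x. (deriv ^^ n) \<phi> field_differentiable (at x))}"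

definition has_weak_deriv_torus :: "(real \<Rightarrow> real) \<Rightarrow> (real \<Rightarrow> real) \<Rightarrow> bool" where
  "has_weak_deriv_torus f g \<longleftrightarrow>
     (\<forall>\<phi>\<in>test_fun_torus. (\<integral>x. f x * deriv \<phi> x \<partial>torus) = - (\<integral>x. g x * \<phi> x \<partial>torus))"

text \<open>
  \<open>H1_torus f g\<close>: \<open>f\<close> lies in the Sobolev space \<open>H\<^sup>1\<close> and \<open>g\<close> is (a representative of)
  its weak derivative, which is unique up to null sets.
\<close>

definition H1_torus :: "(real \<Rightarrow> real) \<Rightarrow> (real \<Rightarrow> real) \<Rightarrow> bool" where
  "H1_torus f g \<longleftrightarrow> f \<in> L2_torus \<and> g \<in> L2_torus \<and> has_weak_deriv_torus f g"

text \<open>Any admissible constant is allowed, in particular the optimal one.\<close>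

definition poincare_wirtinger_const :: "real \<Rightarrow> bool" where
  "poincare_wirtinger_const C \<longleftrightarrow> 0 < C \<and>
     (\<forall>f g. H1_torus f g \<longrightarrow> L2_norm_torus (\<lambda>x. f x - mean_torus f) \<le> C * L2_norm_torus g)"

definition first_order_entropy :: "real \<Rightarrow> (real \<Rightarrow> real) \<Rightarrow> real" where
  "first_order_entropy \<alpha> v =
     1 / 2 * (\<integral>x. (deriv (\<lambda>y. v y powr (\<alpha> / 2)) x)\<^sup>2 \<partial>torus)"

text \<open>
  \<open>u t x\<close> is infinitely differentiable on the closed strip \<open>{0..T} \<times> \<real>\<close>: \<open>D i j\<close> is the partial
  derivative of order \<open>i\<close> in time (one-sided at \<open>0\<close> and \<open>T\<close>) and \<open>j\<close> in space, and all of them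
  are jointly continuous up to the boundary.
\<close>

definition smooth_strip :: "real \<Rightarrow> (real \<Rightarrow> real \<Rightarrow> real) \<Rightarrow> bool" where
  "smooth_strip T u \<longleftrightarrow>
     (\<exists>D :: nat \<Rightarrow> nat \<Rightarrow> real \<Rightarrow> real \<Rightarrow> real.
        (\<forall>t\<in>{0..T}. \<forall>x. D 0 0 t x = u t x) \<and>
        (\<forall>i j. continuous_on ({0..T} \<times> UNIV) (\<lambda>(t, x). D i j t x)) \<and>
        (\<forall>i j. \<forall>t\<in>{0..T}. \<forall>x.
           ((\<lambda>s. D i j s x) has_real_derivative D (Suc i) j t x) (at t within {0..T}) \<and>
           (D i j t has_real_derivative D i (Suc j) t x) (at x)))"

definition smooth_positive_solution ::
  "real \<Rightarrow> real \<Rightarrow> (real \<Rightarrow> real) \<Rightarrow> (real \<Rightarrow> real \<Rightarrow> real) \<Rightarrow> bool" where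
  "smooth_positive_solution \<beta> T u0 u \<longleftrightarrow>
     smooth_strip T u \<and>
     (\<forall>t\<in>{0..T}. periodic_fun_simple' (u t)) \<and>
     (\<forall>t\<in>{0..T}. \<forall>x. 0 < u t x) \<and>
     (\<forall>t\<in>{0<..T}. \<forall>x.
        ((\<lambda>s. u s x) has_real_derivative deriv (deriv (\<lambda>y. u t y powr \<beta>)) x)
          (at t within {0..T})) \<and>
     (\<forall>x. u 0 x = u0 x)"

end

theory Submission
  imports Defs
begin

text \<open>
  Put \<open>q = u\<^sub>x / u\<close>, \<open>p = q\<^sub>x\<close> and \<open>m = \<alpha> + \<beta> - 1\<close>. Then
  \<open>F\<^sub>\<alpha>' = -(\<alpha>\<^sup>2 \<beta> / 8) \<integral> u\<^sup>m (2p + \<alpha>q\<^sup>2)(p + \<beta>q\<^sup>2) dx\<close>.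
  Subtracting a multiple of the null integral \<open>\<integral> (u\<^sup>m q\<^sup>3)\<^sub>x dx\<close> turns the integrand into \<open>u\<^sup>m\<close>
  times \<open>2 (p + m/3 q\<^sup>2)\<^sup>2 + (1 - d)(d + 2)/9 q\<^sup>4\<close> with \<open>d = \<alpha> - 2\<beta>\<close>, and the last term is
  nonnegative. As \<open>g = u\<^bsup>\<gamma>/2\<^esup> q\<close> is the derivative of a periodic function and
  \<open>g\<^sub>x = u\<^bsup>\<gamma>/2\<^esup> (p + m/3 q\<^sup>2)\<close>, the Poincare-Wirtinger inequality for \<open>g\<close> bounds the dissipation
  below by \<open>\<Lambda> F\<^sub>\<alpha>\<close>, the maximum principle having reduced the powers of \<open>u\<close> to those of \<open>u\<^sub>0\<close>.
\<close>

subsection \<open>Calculus on the torus\<close>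

text \<open>Passage from Lebesgue integrals over the half-open period to gauge integrals over
  \<open>{0..1}\<close>, for which the fundamental theorem of calculus and the Leibniz rule are
  applied later.\<close>

lemma
  fixes f :: "real \<Rightarrow> real"
  assumes "continuous_on UNIV f"
  shows integrable_torus_continuous: "integrable torus f"
    and integral_torus_continuous: "(\<integral>x. f x \<partial>torus) = integral {0..1} f"
proof -
  have "set_integrable lborel {0..1} f"
    by (rule borel_integrable_atLeastAtMost') (rule continuous_on_subset[OF assms], simp)
  then have int: "set_integrable lborel {0..<1} f"
    by (rule set_integrable_subset) auto
  then show "integrable torus f"
    by (simp add: torus_def integrable_restrict_space set_integrable_def)
  have "(\<integral>x. f x \<partial>torus) = (LINT x : {0..<1} | lborel. f x)"
    by (simp add: torus_def integral_restrict_space set_lebesgue_integral_def)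
  also have "\<dots> = integral {0..<1} f"
    by (rule set_borel_integral_eq_integral[OF int])
  also have "\<dots> = integral {0..1} f"
    by (rule integral_spike_set) (auto intro: negligible_subset[of "{1}"])
  finally show "(\<integral>x. f x \<partial>torus) = integral {0..1} f" .
qed

lemma integral_periodic_deriv:
  fixes f f' :: "real \<Rightarrow> real"
  assumes "\<And>x. (f has_real_derivative f' x) (at x)" and "\<And>x. f (x + 1) = f x"
  shows "integral {0..1} f' = 0"
proof -
  have "(f' has_integral (f 1 - f 0)) {0..1}"
    by (rule fundamental_theorem_of_calculus)
      (simp_all add: DERIV_subset[OF assms(1)] flip: has_real_derivative_iff_has_vector_derivative)
  then show ?thesis
    using assms(2)[of 0] by (simp add: integral_unique)
qed

lemma periodic_deriv:
  fixes f f' :: "real \<Rightarrow> real"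
  assumes "\<And>x. (f has_real_derivative f' x) (at x)" and "\<And>x. f (x + 1) = f x"
  shows "f' (x + 1) = f' x"
proof (rule DERIV_unique)
  show "(f has_real_derivative f' x) (at x)" by (rule assms(1))
  have "((\<lambda>x. f (x + 1)) has_real_derivative f' (x + 1)) (at x)"
    using assms(1)[of "x + 1"] DERIV_shift by blast
  then show "(f has_real_derivative f' (x + 1)) (at x)"
    using assms(2) by simp
qed

lemma DERIV_unique_within_Icc:
  fixes f :: "real \<Rightarrow> real"
  assumes "a < b" "x \<in> {a..b}"
    and "(f has_real_derivative d) (at x within {a..b})"
    and "(f has_real_derivative e) (at x within {a..b})"
  shows "d = e"
  using vector_derivative_unique_within_closed_interval[of a b x f d e] assms
  by (simp add: has_real_derivative_iff_has_vector_derivative)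

text \<open>Integration by parts against a test function has no boundary terms, because the
  derivative of the periodic product \<open>g x * \<phi> x\<close> integrates to zero. This makes
  classical functions admissible in the Poincare-Wirtinger hypothesis.\<close>

lemma H1_torus_C1:
  assumes g: "\<And>x. (g has_real_derivative g' x) (at x)"
    and g': "continuous_on UNIV g'" and per: "\<And>x. g (x + 1) = g x"
  shows "H1_torus g g'"
proof -
  have cont: "continuous_on UNIV g"
    using g by (meson DERIV_isCont continuous_at_imp_continuous_on)
  have L2: "f \<in> L2_torus" if "continuous_on UNIV f" for f :: "real \<Rightarrow> real"
    using that integrable_torus_continuous[OF that] integrable_torus_continuous[of "\<lambda>x. (f x)\<^sup>2"]
    by (auto simp: L2_torus_def intro!: continuous_intros)
  have "(\<integral>x. g x * deriv \<phi> x \<partial>torus) = - (\<integral>x. g' x * \<phi> x \<partial>torus)"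
    if "\<phi> \<in> test_fun_torus" for \<phi>
  proof -
    have per\<phi>: "\<phi> (x + 1) = \<phi> x" for x
      using that by (simp add: test_fun_torus_def periodic_fun_simple'_def)
    have diff: "(deriv ^^ n) \<phi> field_differentiable (at x)" for n x
      using that by (simp add: test_fun_torus_def)
    have \<phi>: "(\<phi> has_real_derivative deriv \<phi> x) (at x)" for x
      using diff[of 0 x] by (simp add: DERIV_deriv_iff_field_differentiable)
    have c0: "continuous_on UNIV \<phi>"
      using \<phi> by (meson DERIV_isCont continuous_at_imp_continuous_on)
    have c1: "continuous_on UNIV (deriv \<phi>)"
      using diff[of 1]
      by (auto intro!: continuous_at_imp_continuous_on field_differentiable_imp_continuous_at)
    have "integral {0..1} (\<lambda>x. g x * deriv \<phi> x + g' x * \<phi> x) = 0"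
      by (rule integral_periodic_deriv[where f = "\<lambda>x. g x * \<phi> x"])
        (auto intro!: derivative_eq_intros g \<phi> simp: per per\<phi>)
    moreover have "integral {0..1} (\<lambda>x. g x * deriv \<phi> x + g' x * \<phi> x)
      = integral {0..1} (\<lambda>x. g x * deriv \<phi> x) + integral {0..1} (\<lambda>x. g' x * \<phi> x)"
      by (intro integral_add integrable_continuous_real continuous_intros
          continuous_on_subset[OF cont] continuous_on_subset[OF c0]
          continuous_on_subset[OF c1] continuous_on_subset[OF g'] subset_UNIV)
    ultimately show ?thesis
      by (simp add: integral_torus_continuous continuous_intros cont c0 c1 g')
  qed
  then show ?thesis
    using L2 cont g' by (simp add: H1_torus_def has_weak_deriv_torus_def)
qed

lemma poincare_wirtinger_C1:
  assumes C: "poincare_wirtinger_const C"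
    and g: "\<And>x. (g has_real_derivative g' x) (at x)"
    and g': "continuous_on UNIV g'" and per: "\<And>x. g (x + 1) = g x"
    and mean: "integral {0..1} g = 0"
  shows "integral {0..1} (\<lambda>x. (g x)\<^sup>2) \<le> C\<^sup>2 * integral {0..1} (\<lambda>x. (g' x)\<^sup>2)"
proof -
  have cont: "continuous_on UNIV g"
    using g by (meson DERIV_isCont continuous_at_imp_continuous_on)
  have "mean_torus g = 0"
    using mean by (simp add: mean_torus_def integral_torus_continuous cont)
  moreover have "L2_norm_torus (\<lambda>x. g x - mean_torus g) \<le> C * L2_norm_torus g'"
    using C H1_torus_C1[OF g g' per] by (simp add: poincare_wirtinger_const_def)
  ultimately have "(L2_norm_torus g)\<^sup>2 \<le> (C * L2_norm_torus g')\<^sup>2"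
    by (intro power_mono) (auto simp: L2_norm_torus_def)
  moreover have "(L2_norm_torus f)\<^sup>2 = integral {0..1} (\<lambda>x. (f x)\<^sup>2)"
    if "continuous_on UNIV f" for f
    using that
    by (simp add: L2_norm_torus_def integral_torus_continuous continuous_intros integral_nonneg
        integrable_continuous_real continuous_on_subset)
  ultimately show ?thesis
    using cont g' by (simp add: power_mult_distrib)
qed

text \<open>Keeping the exponent \<open>s\<close> and splitting off the logarithmic derivative,
  instead of lowering the exponent, lets all later computations run in terms of q and its
  derivatives with a fixed power of u in front.\<close>

lemma has_real_derivative_powr_const:
  fixes f :: "real \<Rightarrow> real"
  assumes "(f has_real_derivative f') (at x within S)" and "f x > 0"
  shows "((\<lambda>x. f x powr s) has_real_derivative s * f x powr s * (f' / f x)) (at x within S)"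
  using DERIV_chain2[OF has_real_derivative_powr[OF assms(2), of s] assms(1)] assms(2)
  by (simp add: powr_diff)


subsection \<open>The maximum principle\<close>

text \<open>If \<open>l\<close> were positive, \<open>f'\<close> would be positive just to the right
  of its zero \<open>x\<close>, and \<open>f\<close> would rise above its maximum there.\<close>

lemma second_deriv_nonpos_at_max:
  fixes f f' :: "real \<Rightarrow> real"
  assumes f: "\<And>x. (f has_real_derivative f' x) (at x)"
    and f': "(f' has_real_derivative l) (at x)"
    and max: "\<And>y. f y \<le> f x"
  shows "f' x = 0" and "l \<le> 0"
proof -
  show 0: "f' x = 0"
    by (rule DERIV_local_max[OF f zero_less_one]) (use max in auto)
  show "l \<le> 0"
  proof (rule ccontr)
    assume "\<not> l \<le> 0"
    then obtain d where d: "d > 0" "\<And>h. 0 < h \<Longrightarrow> h < d \<Longrightarrow> 0 < f' (x + h)"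
      using DERIV_pos_inc_right[OF f'] 0 by auto
    have "f x < f (x + d / 2)"
    proof (rule DERIV_pos_imp_increasing_open[where f = f])
      show "\<exists>l. (f has_real_derivative l) (at y) \<and> 0 < l" if "x < y" "y < x + d / 2" for y
        using that d(2)[of "y - x"] f[of y] d(1) by auto
      show "continuous_on {x..x + d / 2} f"
        using f by (meson DERIV_isCont continuous_at_imp_continuous_on)
    qed (use d(1) in simp)
    with max[of "x + d / 2"] show False by simp
  qed
qed

text \<open>The sign condition \<open>parabolic\<close> is asked only where the first and second
  derivative tests for a spatial maximum hold; this fits a nonlinear equation whose gradient terms
  vanish at critical points. Bounding by a value of \<open>f 0\<close> at a point, not by a
  supremum, suits the later comparison with infima of powers.\<close>

lemma parabolic_maximum_principle:
  fixes f ft fx fxx :: "real \<Rightarrow> real \<Rightarrow> real"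
  assumes cont: "continuous_on ({0..T} \<times> UNIV) (\<lambda>(t, x). f t x)"
    and per: "\<And>t. t \<in> {0..T} \<Longrightarrow> periodic_fun_simple' (f t)"
    and ft: "\<And>t x. t \<in> {0<..T} \<Longrightarrow>
      ((\<lambda>s. f s x) has_real_derivative ft t x) (at t within {0..T})"
    and fx: "\<And>t x. t \<in> {0<..T} \<Longrightarrow> (f t has_real_derivative fx t x) (at x)"
    and fxx: "\<And>t x. t \<in> {0<..T} \<Longrightarrow> (fx t has_real_derivative fxx t x) (at x)"
    and parabolic: "\<And>t x. t \<in> {0<..T} \<Longrightarrow> fx t x = 0 \<Longrightarrow> fxx t x \<le> 0 \<Longrightarrow> ft t x \<le> 0"
    and t: "t \<in> {0..T}"
  shows "\<exists>y\<in>{0..<1}. f t x \<le> f 0 y"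
proof -
  have frac: "f s (frac z) = f s z" if "s \<in> {0..T}" for s z
  proof -
    interpret periodic_fun_simple' "f s" by (rule per[OF that])
    show ?thesis using minus_of_int[of z "\<lfloor>z\<rfloor>"] by (simp add: frac_def)
  qed
  have frac_in: "frac z \<in> {0..1}" "frac z \<in> {0..<1}" for z :: real
    by (auto simp: frac_lt_1 less_imp_le)
  have "continuous_on {0..1} (f 0)"
    by (rule continuous_on_compose2[OF cont, of _ "Pair 0", simplified])
      (use t in \<open>auto intro!: continuous_intros\<close>)
  then obtain y where y: "y \<in> {0..1}" "\<And>z. z \<in> {0..1} \<Longrightarrow> f 0 z \<le> f 0 y"
    using continuous_attains_sup[of "{0..1::real}" "f 0"] by auto
  \<comment> \<open>The tilt by \<epsilon> times time makes the time derivative strictly negative at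
    a spatial maximum, so the maximum of the tilted function over the strip can only sit at time 0.
    Afterwards \<epsilon> tends to 0.\<close>
  have perturbed: "f t x \<le> f 0 y + \<epsilon> * t" if "\<epsilon> > 0" for \<epsilon>
  proof -
    have "continuous_on ({0..T} \<times> {0..1}) (\<lambda>(s, z). f s z - \<epsilon> * s)"
      using continuous_on_subset[OF cont, of "{0..T} \<times> {0..1}"]
      by (auto simp: case_prod_beta intro!: continuous_intros)
    moreover have "compact ({0..T} \<times> {0..1::real})"
      by (intro compact_Times compact_Icc)
    moreover have "{0..T} \<times> {0..1::real} \<noteq> {}"
      using t by auto
    ultimately obtain p where p: "p \<in> {0..T} \<times> {0..1}"
        "\<forall>q\<in>{0..T} \<times> {0..1}. (\<lambda>(s, z). f s z - \<epsilon> * s) q \<le> (\<lambda>(s, z). f s z - \<epsilon> * s) p"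
      using continuous_attains_sup by blast
    obtain s0 z0 where p_eq: "p = (s0, z0)" by fastforce
    with p have s0: "s0 \<in> {0..T}" and z0: "z0 \<in> {0..1}"
      and max01: "\<And>s z. s \<in> {0..T} \<Longrightarrow> z \<in> {0..1} \<Longrightarrow> f s z - \<epsilon> * s \<le> f s0 z0 - \<epsilon> * s0"
      by auto
    \<comment> \<open>Periodicity makes the maximum over one period global in space, so the
      derivative tests also apply when \<open>z0\<close> is 0 or 1.\<close>
    have max: "f s z - \<epsilon> * s \<le> f s0 z0 - \<epsilon> * s0" if "s \<in> {0..T}" for s z
      using max01[OF that frac_in(1)[of z]] frac[OF that] by simp
    have "s0 = 0"
    proof (rule ccontr)
      assume "s0 \<noteq> 0"
      with s0 have s0': "s0 \<in> {0<..T}" by auto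
      have "f s0 z \<le> f s0 z0" for z
        using max[OF s0, of z] by simp
      from second_deriv_nonpos_at_max[OF fx[OF s0'] fxx[OF s0'] this]
      have "ft s0 z0 \<le> 0" by (rule parabolic[OF s0'])
      moreover have "((\<lambda>s. f s z0 - \<epsilon> * s) has_real_derivative ft s0 z0 - \<epsilon>) (at s0 within {0..T})"
        by (auto intro!: derivative_eq_intros ft[OF s0'])
      \<comment> \<open>Only earlier times are inspected, so the one-sided derivative is enough when
        \<open>s0\<close> equals \<open>T\<close>.\<close>
      ultimately obtain d where d: "d > 0"
        "\<And>h. h > 0 \<Longrightarrow> s0 - h \<in> {0..T} \<Longrightarrow> h < d \<Longrightarrow>
          f s0 z0 - \<epsilon> * s0 < f (s0 - h) z0 - \<epsilon> * (s0 - h)"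
        using has_real_derivative_neg_dec_left[of "\<lambda>s. f s z0 - \<epsilon> * s" "ft s0 z0 - \<epsilon>" s0 "{0..T}"]
          \<open>\<epsilon> > 0\<close> by auto
      define h where "h = min (d / 2) s0"
      have "h > 0" "h < d" "s0 - h \<in> {0..T}"
        using d(1) s0' by (auto simp: h_def min_def)
      with d(2)[of h] max[of "s0 - h" z0] show False by simp
    qed
    with max[OF t, of x] y(2)[OF z0] show ?thesis by simp
  qed
  have "f t x \<le> f 0 y"
  proof (rule field_le_epsilon)
    fix e :: real assume "e > 0"
    then have "e * t \<le> e * (T + 1)"
      using t by (intro mult_left_mono) auto
    \<comment> \<open>Dividing by \<open>T + 1\<close> rather than \<open>T\<close> also covers
      \<open>T = 0\<close>.\<close>
    then have "e / (T + 1) * t \<le> e"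
      using t by (simp add: field_simps)
    with perturbed[of "e / (T + 1)"] \<open>e > 0\<close> t show "f t x \<le> f 0 y + e" by force
  qed
  then show ?thesis
    using frac[of 0 y] frac_in(2)[of y] t by (intro bexI[of _ "frac y"]) auto
qed

subsection \<open>Dissipation of the entropy\<close>

text \<open>An inequality for one positive periodic profile at a fixed time, with \<open>Q\<close>
  and \<open>P\<close> standing for q and p. The bound \<open>k1\<close> replaces the power of u
  left over beside the square of \<open>g'\<close>, and \<open>k2\<close> the one separating the
  square of \<open>g\<close> from the entropy density.\<close>

lemma entropy_dissipation_bound:
  fixes u Q P :: "real \<Rightarrow> real" and \<alpha> \<beta> \<gamma> :: real
  assumes pos: "\<And>x. u x > 0" and u: "\<And>x. (u has_real_derivative u x * Q x) (at x)"
    and Q: "\<And>x. (Q has_real_derivative P x) (at x)" and P: "continuous_on UNIV P"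
    and per_u: "\<And>x. u (x + 1) = u x" and per_Q: "\<And>x. Q (x + 1) = Q x"
    and C: "poincare_wirtinger_const C"
    and ab: "-2 \<le> \<alpha> - 2 * \<beta>" "\<alpha> - 2 * \<beta> \<le> 1"
    and \<gamma>: "\<gamma> = 2 / 3 * (\<alpha> + \<beta> - 1)"
    and k1: "k1 \<ge> 0" "\<And>x. k1 \<le> u x powr (\<alpha> + \<beta> - \<gamma> - 1)"
    and k2: "\<And>x. k2 \<le> u x powr (\<gamma> - \<alpha>)"
  shows "2 * k1 * k2 / C\<^sup>2 * integral {0..1} (\<lambda>x. u x powr \<alpha> * (Q x)\<^sup>2) \<le>
    integral {0..1} (\<lambda>x. u x powr (\<alpha> + \<beta> - 1) * (2 * P x + \<alpha> * (Q x)\<^sup>2) * (P x + \<beta> * (Q x)\<^sup>2))"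
proof -
  define m where "m = \<alpha> + \<beta> - 1"
  have \<gamma>m: "\<gamma> = 2 * (m / 3)" by (simp add: \<gamma> m_def)
  define g where "g = (\<lambda>x. u x powr (m / 3) * Q x)"
  define g' where "g' = (\<lambda>x. u x powr (m / 3) * (P x + m / 3 * (Q x)\<^sup>2))"
  have u_nz [simp]: "u x \<noteq> 0" for x using pos[of x] by simp
  have powr': "((\<lambda>x. u x powr s) has_real_derivative s * u x powr s * Q x) (at x)" for s x
    using has_real_derivative_powr_const[OF u pos, of s x] by simp
  have cu: "continuous_on UNIV u" and cQ: "continuous_on UNIV Q"
    using u Q by (meson DERIV_isCont continuous_at_imp_continuous_on)+
  note cont = continuous_intros continuous_on_subset[OF cu] continuous_on_subset[OF cQ]
    continuous_on_subset[OF P]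
  have g: "(g has_real_derivative g' x) (at x)" for x
    unfolding g_def g'_def
    by (rule powr' Q derivative_eq_intros refl)+ (simp add: algebra_simps power2_eq_square)
  have per_g: "g (x + 1) = g x" for x by (simp add: g_def per_u per_Q)
  have cg: "continuous_on UNIV g" and cg': "continuous_on UNIV g'"
    unfolding g_def g'_def by (auto intro!: cont)
  have mean: "integral {0..1} g = 0"
  \<comment> \<open>\<open>g\<close> has a periodic primitive: ln u if the exponent m/3 vanishes,
    and 3/m times \<open>u x powr (m / 3)\<close> otherwise.\<close>
  proof (cases "m = 0")
    case True
    have "((\<lambda>x. ln (u x)) has_real_derivative g x) (at x)" for x
      using pos[of x] by (auto intro!: derivative_eq_intros u simp: g_def True)
    then show ?thesis by (rule integral_periodic_deriv) (simp add: per_u)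
  next
    case False
    have "((\<lambda>x. 3 / m * u x powr (m / 3)) has_real_derivative g x) (at x)" for x
      using DERIV_cmult[OF powr'[of "m / 3" x], of "3 / m"] False by (simp add: g_def mult.assoc)
    then show ?thesis by (rule integral_periodic_deriv) (simp add: per_u)
  qed
  have C_pos: "C > 0" using C by (simp add: poincare_wirtinger_const_def)
  note int = integrable_continuous_real continuous_on_subset[OF cg] continuous_on_subset[OF cg'] cont
  \<comment> \<open>\<open>R\<close> is the derivative of \<open>u x powr m * (Q x) ^ 3\<close>, so
    any multiple of it may be added under the integral.\<close>
  define R where "R = (\<lambda>x. u x powr m * (3 * (Q x)\<^sup>2 * P x + m * (Q x) ^ 4))"
  have int_R: "integral {0..1} R = 0"
  proof (rule integral_periodic_deriv)
    show "((\<lambda>x. u x powr m * (Q x) ^ 3) has_real_derivative R x) (at x)" for x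
      unfolding R_def
      by (rule powr' Q derivative_eq_intros refl)+
        (simp add: algebra_simps power2_eq_square power3_eq_cube power4_eq_xxxx)
  qed (simp add: per_u per_Q)
  \<comment> \<open>This value is forced by matching the coefficients of p q^2: 4m/3 + 6c = \<alpha>
    + 2\<beta>.\<close>
  define c where "c = \<alpha> / 6 + \<beta> / 3 - 2 * m / 9"
  have "k2 * integral {0..1} (\<lambda>x. u x powr \<alpha> * (Q x)\<^sup>2) \<le> integral {0..1} (\<lambda>x. (g x)\<^sup>2)"
  proof -
    have "k2 * (u x powr \<alpha> * (Q x)\<^sup>2) \<le> (g x)\<^sup>2" for x
    proof -
      have "k2 * (u x powr \<alpha> * (Q x)\<^sup>2) \<le> u x powr (\<gamma> - \<alpha>) * (u x powr \<alpha> * (Q x)\<^sup>2)"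
        by (intro mult_right_mono k2) auto
      also have "\<dots> = u x powr \<gamma> * (Q x)\<^sup>2" by (simp flip: powr_add mult.assoc)
      also have "\<dots> = (g x)\<^sup>2"
        by (simp add: g_def power_mult_distrib \<gamma>m power2_eq_square flip: powr_add)
      finally show ?thesis .
    qed
    then have "integral {0..1} (\<lambda>x. k2 * (u x powr \<alpha> * (Q x)\<^sup>2)) \<le> integral {0..1} (\<lambda>x. (g x)\<^sup>2)"
      by (intro integral_le int) auto
    then show ?thesis by simp
  qed
  also have "\<dots> \<le> C\<^sup>2 * integral {0..1} (\<lambda>x. (g' x)\<^sup>2)"
    by (rule poincare_wirtinger_C1[OF C g cg' per_g mean])
  finally have "2 * k1 * (k2 * integral {0..1} (\<lambda>x. u x powr \<alpha> * (Q x)\<^sup>2)) / C\<^sup>2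
      \<le> 2 * k1 * (C\<^sup>2 * integral {0..1} (\<lambda>x. (g' x)\<^sup>2)) / C\<^sup>2"
    using k1(1) by (intro divide_right_mono mult_left_mono) auto
  also have "\<dots> = integral {0..1} (\<lambda>x. 2 * k1 * (g' x)\<^sup>2 + 2 * c * R x)"
    using C_pos int_R
    by (subst integral_add) (auto intro!: int simp: R_def)
  also have "\<dots> \<le> integral {0..1}
      (\<lambda>x. u x powr m * (2 * P x + \<alpha> * (Q x)\<^sup>2) * (P x + \<beta> * (Q x)\<^sup>2))"
  proof (rule integral_le)
    fix x
    let ?d = "\<alpha> - 2 * \<beta>"
    have "k1 * (g' x)\<^sup>2 \<le> u x powr (m - \<gamma>) * (g' x)\<^sup>2"
      using k1(2)[of x] by (intro mult_right_mono) (auto simp: m_def algebra_simps)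
    also have "\<dots> = u x powr m * (P x + m / 3 * (Q x)\<^sup>2)\<^sup>2"
      by (simp add: g'_def \<gamma>m power_mult_distrib power2_eq_square flip: powr_add mult.assoc)
    finally have *: "k1 * (g' x)\<^sup>2 \<le> u x powr m * (P x + m / 3 * (Q x)\<^sup>2)\<^sup>2" .
    have "(2 * P x + \<alpha> * (Q x)\<^sup>2) * (P x + \<beta> * (Q x)\<^sup>2) =
        2 * (P x + m / 3 * (Q x)\<^sup>2)\<^sup>2 + 2 * c * (3 * (Q x)\<^sup>2 * P x + m * (Q x) ^ 4)
        + (1 - ?d) * (?d + 2) / 9 * (Q x) ^ 4"
      by (simp add: c_def m_def field_simps power2_eq_square power4_eq_xxxx)
    \<comment> \<open>The range of \<alpha> - 2\<beta> enters here: it makes the coefficient (1 -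
      d)(d + 2)/9 of the quartic remainder nonnegative.\<close>
    also have "\<dots> \<ge> 2 * (P x + m / 3 * (Q x)\<^sup>2)\<^sup>2 + 2 * c * (3 * (Q x)\<^sup>2 * P x + m * (Q x) ^ 4)"
      using ab by simp
    finally have "u x powr m * (2 * (P x + m / 3 * (Q x)\<^sup>2)\<^sup>2
          + 2 * c * (3 * (Q x)\<^sup>2 * P x + m * (Q x) ^ 4))
        \<le> u x powr m * ((2 * P x + \<alpha> * (Q x)\<^sup>2) * (P x + \<beta> * (Q x)\<^sup>2))"
      by (intro mult_left_mono) auto
    with * show "2 * k1 * (g' x)\<^sup>2 + 2 * c * R x
        \<le> u x powr m * (2 * P x + \<alpha> * (Q x)\<^sup>2) * (P x + \<beta> * (Q x)\<^sup>2)"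
      by (simp add: R_def algebra_simps)
  qed (auto intro!: int simp: R_def)
  finally show ?thesis by (simp add: m_def mult.assoc)
qed


text \<open>Differentiation under the integral sign followed by one integration by parts in space,
  which removes the mixed derivative \<open>utx\<close>. The equation is substituted for
  \<open>ut\<close> only afterwards.\<close>

lemma entropy_time_derivative:
  fixes u ut ux uxx utx :: "real \<Rightarrow> real \<Rightarrow> real"
  assumes pos: "\<And>t x. t \<in> {0..T} \<Longrightarrow> u t x > 0"
    and per: "\<And>t x. t \<in> {0..T} \<Longrightarrow> u t (x + 1) = u t x"
    and cont: "continuous_on ({0..T} \<times> UNIV) (\<lambda>(t, x). u t x)"
      "continuous_on ({0..T} \<times> UNIV) (\<lambda>(t, x). ut t x)"
      "continuous_on ({0..T} \<times> UNIV) (\<lambda>(t, x). ux t x)"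
      "continuous_on ({0..T} \<times> UNIV) (\<lambda>(t, x). uxx t x)"
      "continuous_on ({0..T} \<times> UNIV) (\<lambda>(t, x). utx t x)"
    and ut: "\<And>t x. t \<in> {0..T} \<Longrightarrow> ((\<lambda>s. u s x) has_real_derivative ut t x) (at t within {0..T})"
    and ux: "\<And>t x. t \<in> {0..T} \<Longrightarrow> (u t has_real_derivative ux t x) (at x)"
    and uxx: "\<And>t x. t \<in> {0..T} \<Longrightarrow> (ux t has_real_derivative uxx t x) (at x)"
    and uxt: "\<And>t x. t \<in> {0..T} \<Longrightarrow> ((\<lambda>s. ux s x) has_real_derivative utx t x) (at t within {0..T})"
    and utx: "\<And>t x. t \<in> {0..T} \<Longrightarrow> (ut t has_real_derivative utx t x) (at x)"
    and T: "T > 0" and t: "t \<in> {0..T}"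
  shows "((\<lambda>t. integral {0..1} (\<lambda>x. u t x powr \<alpha> * (ux t x / u t x)\<^sup>2)) has_real_derivative
    - integral {0..1} (\<lambda>x. u t x powr \<alpha> * (ut t x / u t x) *
        (2 * (uxx t x / u t x - (ux t x / u t x)\<^sup>2) + \<alpha> * (ux t x / u t x)\<^sup>2)))
    (at t within {0..T})"
proof -
  note powr_x = has_real_derivative_powr_const[OF ux pos]
    and powr_t = has_real_derivative_powr_const[OF ut pos]
  have u_nz: "u t x \<noteq> 0" if "t \<in> {0..T}" for t x using pos[OF that, of x] by simp
  have joint: "continuous_on ({0..T} \<times> {0..1}) (\<lambda>p. h (fst p) (snd p))"
    if "continuous_on ({0..T} \<times> UNIV) (\<lambda>(t, x). h t x)" for h :: "real \<Rightarrow> real \<Rightarrow> real"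
    using continuous_on_subset[OF that, of "{0..T} \<times> {0..1}"] by (auto simp: case_prod_beta)
  have slice: "continuous_on {0..1} (h t)"
    if "continuous_on ({0..T} \<times> UNIV) (\<lambda>(t, x). h t x)" "t \<in> {0..T}" for h :: "real \<Rightarrow> real \<Rightarrow> real" and t
    by (rule continuous_on_compose2[OF that(1), of _ "Pair t", simplified])
      (use that(2) in \<open>auto intro!: continuous_intros\<close>)
  note slices = slice[OF cont(1)] slice[OF cont(2)] slice[OF cont(3)] slice[OF cont(4)]
    slice[OF cont(5)]
  note joints = joint[OF cont(1)] joint[OF cont(2)] joint[OF cont(3)] joint[OF cont(4)]
    joint[OF cont(5)]
  define e where "e = (\<lambda>t x. u t x powr \<alpha> * (ux t x / u t x)\<^sup>2)"
  define et where "et = (\<lambda>t x. \<alpha> * u t x powr \<alpha> * (ut t x / u t x) * (ux t x / u t x)\<^sup>2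
    + u t x powr \<alpha> * (2 * (ux t x / u t x) * ((utx t x * u t x - ux t x * ut t x) / (u t x)\<^sup>2)))"
  \<comment> \<open>With r = u_t / u, this is the space derivative of u^\<alpha> q r.\<close>
  define R where "R = (\<lambda>x. \<alpha> * u t x powr \<alpha> * (ux t x / u t x) * (ux t x / u t x * (ut t x / u t x))
    + u t x powr \<alpha> * ((uxx t x * u t x - ux t x * ux t x) / (u t x)\<^sup>2 * (ut t x / u t x)
      + ux t x / u t x * ((utx t x * u t x - ut t x * ux t x) / (u t x)\<^sup>2)))"
  have R_int: "R integrable_on {0..1}"
    unfolding R_def using u_nz[OF t]
    by (auto intro!: integrable_continuous_real continuous_intros slices t)
  have "((\<lambda>t. integral (cbox 0 1) (e t)) has_real_derivative integral (cbox 0 1) (et t)) (at t within {0..T})"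
  proof (rule leibniz_rule_field_derivative)
    fix s x assume s: "s \<in> {0..T}"
    show "((\<lambda>t. e t x) has_real_derivative et s x) (at s within {0..T})"
      unfolding e_def et_def
      by (rule powr_t[OF s] ut[OF s] uxt[OF s] u_nz[OF s] s derivative_eq_intros refl)+
        (simp add: power2_eq_square algebra_simps)
  next
    fix s assume s: "s \<in> {0..T}"
    show "e s integrable_on cbox 0 1"
      unfolding e_def using u_nz[OF s]
      by (auto intro!: integrable_continuous_real continuous_intros slices s)
  next
    show "continuous_on ({0..T} \<times> cbox 0 1) (\<lambda>(t, x). et t x)"
      unfolding et_def case_prod_beta using u_nz
      by (auto intro!: continuous_intros joints)
  qed (use t in auto)
  \<comment> \<open>The key identity is q_t = r_x, both being the mixed second derivative of ln u.
    Hence \<open>et\<close> is \<alpha> u^\<alpha> r q^2 + 2 u^\<alpha> q r_x, and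
    \<open>2 * R\<close> absorbs the term with r_x.\<close>
  also have "integral (cbox 0 1) (et t) = integral {0..1} (\<lambda>x. 2 * R x - u t x powr \<alpha> * (ut t x / u t x) *
        (2 * (uxx t x / u t x - (ux t x / u t x)\<^sup>2) + \<alpha> * (ux t x / u t x)\<^sup>2))"
    unfolding box_real using u_nz[OF t]
    by (intro integral_cong) (simp add: et_def R_def field_simps power2_eq_square)
  also have "\<dots> = 2 * integral {0..1} R - integral {0..1} (\<lambda>x. u t x powr \<alpha> * (ut t x / u t x) *
        (2 * (uxx t x / u t x - (ux t x / u t x)\<^sup>2) + \<alpha> * (ux t x / u t x)\<^sup>2))"
    using u_nz[OF t] R_int
    by (subst integral_diff) (auto intro!: integrable_continuous_real continuous_intros slices t)
  also have "integral {0..1} R = 0"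
  proof (rule integral_periodic_deriv)
    show "((\<lambda>x. u t x powr \<alpha> * (ux t x / u t x * (ut t x / u t x))) has_real_derivative R x) (at x)" for x
      unfolding R_def
      by (rule powr_x[OF t t] ux[OF t] uxx[OF t] utx[OF t] u_nz[OF t] derivative_eq_intros refl)+
        (simp add: power2_eq_square algebra_simps)
    have ux_per: "ux t (x + 1) = ux t x" for x
      by (rule periodic_deriv[OF ux[OF t] per[OF t]])
    \<comment> \<open>The time derivative inherits the period because u is periodic at every time of
      the strip and derivatives within \<open>{0..T}\<close> are unique.\<close>
    have "ut t (x + 1) = ut t x" for x
    proof -
      have "((\<lambda>s. u s (x + 1)) has_real_derivative ut t (x + 1)) (at t within {0..T})"
        by (rule ut[OF t])
      then have "((\<lambda>s. u s x) has_real_derivative ut t (x + 1)) (at t within {0..T})"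
        by (rule has_field_derivative_transform_within[OF _ zero_less_one t]) (simp add: per)
      then show ?thesis
        by (rule DERIV_unique_within_Icc[OF T t _ ut[OF t]])
    qed
    then show "u t (x + 1) powr \<alpha> * (ux t (x + 1) / u t (x + 1) * (ut t (x + 1) / u t (x + 1))) =
        u t x powr \<alpha> * (ux t x / u t x * (ut t x / u t x))" for x
      by (simp add: per[OF t] ux_per)
  qed
  finally show ?thesis by (simp add: e_def)
qed


section \<open>Infima of powers and Gronwall's inequality\<close>

lemma powr_bound_of_bounds:
  fixes u0 :: "'a \<Rightarrow> real"
  assumes pos: "\<And>x. x \<in> A \<Longrightarrow> u0 x > 0"
    and y: "y \<in> A" "u0 y \<le> z" and y': "y' \<in> A" "z \<le> u0 y'"
  shows "(INF x\<in>A. u0 x powr s) \<le> z powr s"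
proof -
  have INF: "(INF x\<in>A. u0 x powr s) \<le> u0 x powr s" if "x \<in> A" for x
    by (rule cINF_lower[OF _ that]) (rule bdd_belowI[of _ 0], auto)
  \<comment> \<open>The sign of \<open>s\<close> decides whether the power increases or decreases,
    hence whether the lower point \<open>y\<close> or the upper point \<open>y'\<close> supplies the
    comparison.\<close>
  show ?thesis
  proof (cases "s \<ge> 0")
    case True
    with pos y have "u0 y powr s \<le> z powr s"
      by (intro powr_mono2) (auto intro: less_imp_le)
    with INF[OF y(1)] show ?thesis by simp
  next
    case False
    with pos y y' have "u0 y' powr s \<le> z powr s"
      by (intro powr_mono2') (auto intro: less_le_trans)
    with INF[OF y'(1)] show ?thesis by simp
  qed
qed

text \<open>Gronwall's argument: the product of \<open>F\<close> with the growing exponential has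
  nonpositive derivative. The differential inequality is used at interior times, where the
  derivative is two-sided, and continuity covers the endpoints.\<close>

lemma exponential_decay:
  fixes F F' :: "real \<Rightarrow> real"
  assumes F: "\<And>t. t \<in> {0..T} \<Longrightarrow> (F has_real_derivative F' t) (at t within {0..T})"
    and decay: "\<And>t. t \<in> {0<..<T} \<Longrightarrow> F' t \<le> - c * F t"
    and t: "t \<in> {0..T}"
  shows "F t \<le> F 0 * exp (- c * t)"
proof -
  have "F 0 * exp (c * 0) \<ge> F t * exp (c * t)"
  proof (rule DERIV_nonpos_imp_decreasing_open[where f = "\<lambda>s. F s * exp (c * s)"])
    fix s assume s: "0 < s" "s < t"
    with t have s': "s \<in> {0<..<T}" by auto
    then have "(F has_real_derivative F' s) (at s)"
      using F[of s] at_within_interior[of s "{0..T}"] by (auto simp: interior_atLeastAtMost_real)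
    then have "((\<lambda>s. F s * exp (c * s)) has_real_derivative (F' s + c * F s) * exp (c * s)) (at s)"
      by (auto intro!: derivative_eq_intros simp: algebra_simps)
    moreover have "(F' s + c * F s) * exp (c * s) \<le> 0"
      using decay[OF s'] by (simp add: mult_le_0_iff)
    ultimately show "\<exists>l. ((\<lambda>s. F s * exp (c * s)) has_real_derivative l) (at s) \<and> l \<le> 0"
      by blast
  next
    have "continuous_on {0..T} F"
      using F by (rule DERIV_continuous_on)
    then show "continuous_on {0..t} (\<lambda>s. F s * exp (c * s))"
      using t by (intro continuous_intros) (auto intro: continuous_on_subset)
  qed (use t in auto)
  then have "F t * exp (c * t) * exp (- (c * t)) \<le> F 0 * exp (- (c * t))"
    by (intro mult_right_mono) auto
  then show ?thesis
    by (simp add: mult.assoc flip: exp_add)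
qed

section \<open>Exponential decay along a solution\<close>

theorem theorem7:
  fixes \<alpha> \<beta> \<gamma> T C\<^sub>P \<Lambda> :: real
    and u\<^sub>0 :: "real \<Rightarrow> real"
    and u :: "real \<Rightarrow> real \<Rightarrow> real"
  assumes "\<alpha> > 0" and "\<beta> > 0"
    and "-2 \<le> \<alpha> - 2 * \<beta>" and "\<alpha> - 2 * \<beta> < 1"
    and "T > 0"
    and "u\<^sub>0 \<in> Linf_torus" and "(INF x\<in>{0..<1}. u\<^sub>0 x) \<ge> 0"
    and "smooth_positive_solution \<beta> T u\<^sub>0 u"
    and "poincare_wirtinger_const C\<^sub>P"
    and "\<gamma> = 2 / 3 * (\<alpha> + \<beta> - 1)"
    and "\<Lambda> = 2 * \<beta> / C\<^sub>P\<^sup>2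
               * (INF x\<in>{0..<1}. u\<^sub>0 x powr (\<alpha> + \<beta> - \<gamma> - 1))
               * (INF x\<in>{0..<1}. u\<^sub>0 x powr (\<gamma> - \<alpha>))"
  shows "\<Lambda> \<ge> 0 \<and>
    (\<forall>t\<in>{0..T}. first_order_entropy \<alpha> (u t) \<le> first_order_entropy \<alpha> u\<^sub>0 * exp (- \<Lambda> * t))"
proof -
  note sol = \<open>smooth_positive_solution \<beta> T u\<^sub>0 u\<close>[unfolded smooth_positive_solution_def]
  have u0: "u\<^sub>0 = u 0" using sol by auto
  have pos: "u t x > 0" if "t \<in> {0..T}" for t x using sol that by blast
  have u_nz: "u t x \<noteq> 0" if "t \<in> {0..T}" for t x using pos[OF that, of x] by simp
  have per: "periodic_fun_simple' (u t)" if "t \<in> {0..T}" for t using sol that by blast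
  have per1: "u t (x + 1) = u t x" if "t \<in> {0..T}" for t x
    using per[OF that] by (simp add: periodic_fun_simple'_def)
  have pde: "((\<lambda>s. u s x) has_real_derivative deriv (deriv (\<lambda>y. u t y powr \<beta>)) x) (at t within {0..T})"
    if "t \<in> {0<..T}" for t x using sol that by blast
  obtain D where D00: "\<And>t x. t \<in> {0..T} \<Longrightarrow> D 0 0 t x = u t x"
    and D_cont: "\<And>i j. continuous_on ({0..T} \<times> UNIV) (\<lambda>(t, x). D i j t x)"
    and D_t: "\<And>i j t x. t \<in> {0..T} \<Longrightarrow>
      ((\<lambda>s. D i j s x) has_real_derivative D (Suc i) j t x) (at t within {0..T})"
    and D_x: "\<And>i j t x. t \<in> {0..T} \<Longrightarrow> (D i j t has_real_derivative D i (Suc j) t x) (at x)"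
    using sol unfolding smooth_strip_def by metis
  \<comment> \<open>The single function \<open>D 1 1\<close> is both the time derivative of
    \<open>ux\<close> and the space derivative of \<open>ut\<close>, so equality of mixed
    derivatives comes with the smoothness assumption.\<close>
  define ut ux uxx utx where "ut = D 1 0" and "ux = D 0 1" and "uxx = D 0 2" and "utx = D 1 1"
  note defs = ut_def ux_def uxx_def utx_def
  have u_cont: "continuous_on ({0..T} \<times> UNIV) (\<lambda>(t, x). u t x)"
    using D_cont[of 0 0] by (rule continuous_on_eq) (auto simp: D00)
  have ut: "((\<lambda>s. u s x) has_real_derivative ut t x) (at t within {0..T})" if "t \<in> {0..T}" for t x
    using has_field_derivative_transform_within[OF D_t[OF that, of 0 0 x] zero_less_one that] D00
    by (simp add: ut_def)
  have ux: "(u t has_real_derivative ux t x) (at x)" if "t \<in> {0..T}" for t x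
  proof -
    have "D 0 0 t = u t" using D00[OF that] by auto
    with D_x[OF that, of 0 0 x] show ?thesis by (simp add: ux_def)
  qed
  have uxx: "(ux t has_real_derivative uxx t x) (at x)" if "t \<in> {0..T}" for t x
    using D_x[OF that, of 0 1 x] by (simp add: defs numeral_2_eq_2)
  have uxt: "((\<lambda>s. ux s x) has_real_derivative utx t x) (at t within {0..T})" if "t \<in> {0..T}" for t x
    using D_t[OF that, of 0 1 x] by (simp add: defs)
  have utx: "(ut t has_real_derivative utx t x) (at x)" if "t \<in> {0..T}" for t x
    using D_x[OF that, of 1 0 x] by (simp add: defs)
  define Q P where "Q = (\<lambda>t x. ux t x / u t x)" and "P = (\<lambda>t x. uxx t x / u t x - (ux t x / u t x)\<^sup>2)"
  have Q: "(Q t has_real_derivative P t x) (at x)" if "t \<in> {0..T}" for t x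
    unfolding Q_def P_def
    by (rule ux[OF that] uxx[OF that] u_nz[OF that] derivative_eq_intros refl)+
      (use u_nz[OF that, of x] in \<open>simp add: field_simps power2_eq_square\<close>)
  have uQ: "(u t has_real_derivative u t x * Q t x) (at x)" if "t \<in> {0..T}" for t x
    using ux[OF that, of x] u_nz[OF that, of x] by (simp add: Q_def)
  have powr_x: "((\<lambda>x. u t x powr s) has_real_derivative s * u t x powr s * Q t x) (at x)"
    if "t \<in> {0..T}" for t x s
    using has_real_derivative_powr_const[OF ux[OF that] pos[OF that]] by (simp add: Q_def)
  have deriv_powr: "deriv (\<lambda>y. u t y powr s) = (\<lambda>x. s * u t x powr s * Q t x)"
    if "t \<in> {0..T}" for t s
    using DERIV_imp_deriv[OF powr_x[OF that]] by blast
  \<comment> \<open>The equation in logarithmic variables: u^\<beta> has first derivative \<beta>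
    u^\<beta> q, which is differentiated once more. Uniqueness of the time derivative identifies
    \<open>ut\<close> with the right-hand side.\<close>
  have ut_eq: "ut t x = \<beta> * u t x powr \<beta> * (P t x + \<beta> * (Q t x)\<^sup>2)" if t: "t \<in> {0<..T}" for t x
  proof -
    from t have t': "t \<in> {0..T}" by auto
    have "((\<lambda>x. \<beta> * u t x powr \<beta> * Q t x) has_real_derivative
        \<beta> * u t x powr \<beta> * (P t x + \<beta> * (Q t x)\<^sup>2)) (at x)"
      by (rule powr_x[OF t'] Q[OF t'] derivative_eq_intros refl)+
        (simp add: algebra_simps power2_eq_square)
    then have "deriv (deriv (\<lambda>y. u t y powr \<beta>)) x = \<beta> * u t x powr \<beta> * (P t x + \<beta> * (Q t x)\<^sup>2)"
      by (simp add: deriv_powr[OF t'] DERIV_imp_deriv)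
    with DERIV_unique_within_Icc[OF \<open>T > 0\<close> t' ut[OF t'] pde[OF t]] show ?thesis by simp
  qed
  \<comment> \<open>At a critical point q = 0, so \<open>ut\<close> has the sign of
    \<open>uxx\<close>; this is the sign condition of the maximum principle for both u and
    -u.\<close>
  have sgn_ut: "ut t x = \<beta> * u t x powr \<beta> * (uxx t x / u t x)" if "t \<in> {0<..T}" "ux t x = 0" for t x
    using ut_eq[OF that(1), of x] that(2) by (simp add: P_def Q_def)
  have upper: "\<exists>y\<in>{0..<1}. u t x \<le> u 0 y" if "t \<in> {0..T}" for t x
  proof (rule parabolic_maximum_principle[OF u_cont per ut ux uxx _ that])
    fix t x assume t: "t \<in> {0<..T}" and "ux t x = 0" "uxx t x \<le> 0"
    with sgn_ut[OF t] pos[of t x] \<open>\<beta> > 0\<close> show "ut t x \<le> 0"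
      by (auto simp: mult_le_0_iff divide_le_0_iff)
  qed auto
  have lower: "\<exists>y\<in>{0..<1}. u 0 y \<le> u t x" if "t \<in> {0..T}" for t x
  proof -
    have "\<exists>y\<in>{0..<1}. - u t x \<le> - u 0 y"
    proof (rule parabolic_maximum_principle[where f = "\<lambda>t x. - u t x" and ft = "\<lambda>t x. - ut t x"
          and fx = "\<lambda>t x. - ux t x" and fxx = "\<lambda>t x. - uxx t x", OF _ _ _ _ _ _ that])
      show "continuous_on ({0..T} \<times> UNIV) (\<lambda>(t, x). - u t x)"
        using continuous_on_minus[OF u_cont] by (simp add: case_prod_beta)
      fix t x assume t: "t \<in> {0<..T}" and "- ux t x = 0" "- uxx t x \<le> 0"
      with sgn_ut[OF t] pos[of t x] \<open>\<beta> > 0\<close> show "- ut t x \<le> 0"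
        by auto
    qed (auto intro!: DERIV_minus ut ux uxx simp: periodic_fun_simple'_def per1)
    then show ?thesis by simp
  qed
  define k1 k2 where "k1 = (INF x\<in>{0..<1}. u\<^sub>0 x powr (\<alpha> + \<beta> - \<gamma> - 1))"
    and "k2 = (INF x\<in>{0..<1}. u\<^sub>0 x powr (\<gamma> - \<alpha>))"
  \<comment> \<open>Each value of the solution lies between two values of the initial datum, so the
    infima for \<open>u\<^sub>0\<close> bound the powers at all times, whatever the sign of the
    exponent.\<close>
  have INF_le: "(INF x\<in>{0..<1}. u\<^sub>0 x powr s) \<le> u t x powr s" if t: "t \<in> {0..T}" for t x s
  proof -
    obtain y y' where "y \<in> {0..<1}" "u 0 y \<le> u t x" "y' \<in> {0..<1}" "u t x \<le> u 0 y'"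
      using upper[OF t, of x] lower[OF t, of x] by blast
    then show ?thesis
      unfolding u0 using \<open>T > 0\<close> by (intro powr_bound_of_bounds[of _ _ y _ y'] pos) auto
  qed
  have k: "k1 \<ge> 0" "k2 \<ge> 0"
    unfolding k1_def k2_def by (auto intro!: cINF_greatest)
  have \<Lambda>: "\<Lambda> = 2 * \<beta> / C\<^sub>P\<^sup>2 * k1 * k2"
    using assms(11) by (simp add: k1_def k2_def)
  have cont_Q: "continuous_on UNIV (Q t)" and cont_u: "continuous_on UNIV (u t)"
    if "t \<in> {0..T}" for t
    using Q[OF that] ux[OF that] by (meson DERIV_isCont continuous_at_imp_continuous_on)+
  define I where "I = (\<lambda>t. integral {0..1} (\<lambda>x. u t x powr \<alpha> * (Q t x)\<^sup>2))"
  \<comment> \<open>The factor \<alpha>^2/8 is 1/2 times the square of the \<alpha>/2 produced by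
    differentiating u^(\<alpha>/2).\<close>
  have entropy: "first_order_entropy \<alpha> (u t) = \<alpha>\<^sup>2 / 8 * I t" if t: "t \<in> {0..T}" for t
  proof -
    have eq: "(\<alpha> / 2 * u t x powr (\<alpha> / 2) * Q t x)\<^sup>2 = \<alpha>\<^sup>2 / 4 * (u t x powr \<alpha> * (Q t x)\<^sup>2)" for x
    proof -
      have "(u t x powr (\<alpha> / 2))\<^sup>2 = u t x powr \<alpha>"
        by (simp add: power2_eq_square flip: powr_add)
      then show ?thesis by (simp add: power_mult_distrib power_divide)
    qed
    have "continuous_on UNIV (\<lambda>x. u t x powr \<alpha> * (Q t x)\<^sup>2)"
      using u_nz[OF t] by (auto intro!: continuous_intros cont_Q cont_u t)
    from integral_torus_continuous[OF this] show ?thesis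
      unfolding first_order_entropy_def deriv_powr[OF t] eq I_def by simp
  qed
  define J where "J = (\<lambda>t. integral {0..1} (\<lambda>x. u t x powr \<alpha> * (ut t x / u t x) *
    (2 * P t x + \<alpha> * (Q t x)\<^sup>2)))"
  have I_deriv: "(I has_real_derivative - J t) (at t within {0..T})" if "t \<in> {0..T}" for t
    unfolding I_def J_def Q_def P_def
    by (rule entropy_time_derivative[where utx = utx])
      (use pos per1 u_cont D_cont ut ux uxx uxt utx \<open>T > 0\<close> that in \<open>simp_all add: defs\<close>)
  have decay: "- J t \<le> - \<Lambda> * I t" if t: "t \<in> {0<..<T}" for t
  proof -
    from t have t': "t \<in> {0..T}" "t \<in> {0<..T}" by auto
    have "continuous_on UNIV (uxx t)"
      using D_x[OF t'(1), of 0 2] unfolding uxx_def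
      by (meson DERIV_isCont continuous_at_imp_continuous_on)
    then have cont_P: "continuous_on UNIV (P t)"
      using u_nz[OF t'(1)] cont_Q[OF t'(1)] cont_u[OF t'(1)]
      unfolding P_def Q_def by (auto intro!: continuous_intros)
    have per_Q: "Q t (x + 1) = Q t x" for x
      using periodic_deriv[OF ux[OF t'(1)] per1[OF t'(1)]] per1[OF t'(1)] by (simp add: Q_def)
    have "2 * k1 * k2 / C\<^sub>P\<^sup>2 * I t \<le> integral {0..1} (\<lambda>x. u t x powr (\<alpha> + \<beta> - 1) *
        (2 * P t x + \<alpha> * (Q t x)\<^sup>2) * (P t x + \<beta> * (Q t x)\<^sup>2))"
      unfolding I_def k1_def k2_def
      by (rule entropy_dissipation_bound[OF pos[OF t'(1)] uQ[OF t'(1)] Q[OF t'(1)] cont_P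
            per1[OF t'(1)] per_Q assms(9,3) less_imp_le[OF assms(4)] assms(10)
            k(1)[unfolded k1_def] INF_le[OF t'(1)] INF_le[OF t'(1)]])
    \<comment> \<open>By the equation, u^\<alpha> u_t / u = \<beta> u^(\<alpha>+\<beta>-1) (p +
      \<beta> q^2); this \<beta> becomes the factor \<beta> in \<Lambda>.\<close>
    also have "\<dots> = J t / \<beta>"
    proof -
      have "u t x powr (\<alpha> + \<beta> - 1) * (2 * P t x + \<alpha> * (Q t x)\<^sup>2) * (P t x + \<beta> * (Q t x)\<^sup>2)
          = u t x powr \<alpha> * (ut t x / u t x) * (2 * P t x + \<alpha> * (Q t x)\<^sup>2) / \<beta>" for x
        using \<open>\<beta> > 0\<close> pos[OF t'(1), of x]
        by (simp add: ut_eq[OF t'(2)] powr_add powr_diff)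
      then show ?thesis
        by (simp only: J_def Henstock_Kurzweil_Integration.integral_divide)
    qed
    finally have "\<beta> * (2 * k1 * k2 / C\<^sub>P\<^sup>2 * I t) \<le> J t"
      using \<open>\<beta> > 0\<close> by (simp add: field_simps)
    then show ?thesis by (simp add: \<Lambda> algebra_simps)
  qed
  have "first_order_entropy \<alpha> (u t) \<le> first_order_entropy \<alpha> u\<^sub>0 * exp (- \<Lambda> * t)"
    if t: "t \<in> {0..T}" for t
  proof -
    have "\<alpha>\<^sup>2 / 8 * I t \<le> \<alpha>\<^sup>2 / 8 * (I 0 * exp (- \<Lambda> * t))"
      by (intro mult_left_mono exponential_decay[OF I_deriv decay t]) auto
    moreover have "0 \<in> {0..T}" using \<open>T > 0\<close> by simp
    ultimately show ?thesis
      unfolding u0 by (simp only: entropy t mult.assoc)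
  qed
  moreover have "\<Lambda> \<ge> 0" using k \<open>\<beta> > 0\<close> by (simp add: \<Lambda>)
  ultimately show ?thesis by blast
qed

end
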